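(* Assume that the distribution of $Y_{1,1}$ has a piecewise continuous density $\mu$, and let $\tilde\mu(z)=\exp(\eta z)\mu(z)$. Let $\sigma:[0,\infty)\to\mathbb{R}$ be measurable and bounded, and let $\xi\in[0,1]$. Then $$\mathbb{E}\big(\sigma(Z_1)e^{\eta Z_1^{\xi}}\big)=\int_0^\infty\sigma(z)\,\mu_\xi(z)\,dz,\qquad\text{where}\quad \mu_\xi=\hat F^{-1}\Big(G_{A_1}\big(\hat F(\xi\tilde\mu+(1-\xi)\mu)\big)\Big).$$
   Context: Let $\eta>0$. $A_1$ is a random variable with values in $\{1,2,\dots\}$, $a_k:=\mathbb{P}(A_1=k)$; $(Y_{1,j})_{j\ge1}$ are iid non-negative random variables; $(U_{1,j})_{j\ge1}$ are iid uniform on $[0,1]$; $A_1$, $(Y_{1,j})_j$, $(U_{1,j})_j$ are independent. Standing assumption: $\mathbb{E}(e^{\eta Y_{1,1}})<\infty$ and $\limsup_{k\to\infty}a_{k+1}/a_k<1/\mathbb{E}(e^{\eta Y_{1,1}})$ (with $0/0:=0$ and $y/0:=+\infty$ for $y>0$). Put $Z_1=\sum_{j=1}^{A_1}Y_{1,j}$ and, for $\xi\in[0,1]$, $Z_1^\xi=\sum_{j=1}^{A_1}Y_{1,j}1_{\{U_{1,j}\le\xi\}}$. $G_{A_1}(s)=\sum_{k=1}^\infty a_ks^k$ is the generating function of $A_1$, evaluated at complex $s$ inside its disc of convergence (whose radius exceeds $\mathbb{E}(e^{\eta Y_{1,1}})$ by the standing assumption). $\hat F$ is the Fourier transform on $L^1(\mathbb{R})$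 (functions on $[0,\infty)$ being extended by $0$), normalized so that $\hat F(f\ast g)=\hat F(f)\hat F(g)$ for convolutions, and $\hat F^{-1}$ is its inverse on its range, so that $\mu_\xi$ is determined up to equality almost everywhere. *)

theory Defs
  imports "HOL-Probability.Probability"
begin

definition weight :: "'a measure \<Rightarrow> ('a \<Rightarrow> nat) \<Rightarrow> nat \<Rightarrow> real" where
  "weight M A k = measure M {\<omega> \<in> space M. A \<omega> = k}"

text \<open>
  Division in \<^typ>\<open>ereal\<close> obeys \<open>0 / 0 = 0\<close> and \<open>y / 0 = \<infinity>\<close> for \<open>y > 0\<close>, as required for the
  ratios; \<^typ>\<open>real\<close> division would give \<open>y / 0 = 0\<close>.
\<close>

definition ratio_condition :: "real \<Rightarrow> 'a measure \<Rightarrow> ('a \<Rightarrow> nat) \<Rightarrow> ('a \<Rightarrow> real) \<Rightarrow> bool" where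
  "ratio_condition \<eta> M A Y \<longleftrightarrow>
     integrable M (\<lambda>\<omega>. exp (\<eta> * Y \<omega>)) \<and>
     limsup (\<lambda>k. ereal (weight M A (Suc k)) / ereal (weight M A k))
       < 1 / ereal (integral\<^sup>L M (\<lambda>\<omega>. exp (\<eta> * Y \<omega>)))"

definition gen_fun :: "'a measure \<Rightarrow> ('a \<Rightarrow> nat) \<Rightarrow> complex \<Rightarrow> complex" where
  "gen_fun M A s = (\<Sum>k. complex_of_real (weight M A (Suc k)) * s ^ Suc k)"

definition compound_sum :: "('a \<Rightarrow> nat) \<Rightarrow> (nat \<Rightarrow> 'a \<Rightarrow> real) \<Rightarrow> 'a \<Rightarrow> real" where
  "compound_sum A Y \<omega> = (\<Sum>j = 1..A \<omega>. Y j \<omega>)"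

definition thinned_sum ::
    "('a \<Rightarrow> nat) \<Rightarrow> (nat \<Rightarrow> 'a \<Rightarrow> real) \<Rightarrow> (nat \<Rightarrow> 'a \<Rightarrow> real) \<Rightarrow> real \<Rightarrow> 'a \<Rightarrow> real" where
  "thinned_sum A Y U \<xi> \<omega> = (\<Sum>j = 1..A \<omega>. Y j \<omega> * indicator {..\<xi>} (U j \<omega>))"

text \<open>
  Piecewise continuity on \<open>[0, \<infinity>)\<close>: every bounded interval contains only finitely many
  discontinuities, and the finite one-sided limits exist everywhere. Continuity is taken within
  \<open>[0, \<infinity>)\<close>, so that extending the function by 0 to the left does not matter.
\<close>

definition piecewise_continuous_halfline :: "(real \<Rightarrow> real) \<Rightarrow> bool" where
  "piecewise_continuous_halfline f \<longleftrightarrow>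
     (\<forall>b. finite {x \<in> {0..b}. \<not> continuous (at x within {0..}) f}) \<and>
     (\<forall>x\<ge>0. \<exists>l. (f \<longlongrightarrow> l) (at_right x)) \<and>
     (\<forall>x>0. \<exists>l. (f \<longlongrightarrow> l) (at_left x))"

text \<open>
  The Fourier transform on \<open>L\<^sup>1(\<real>)\<close>, without a factor in front of the integral, so that
  convolutions are mapped to products.
\<close>

definition fourier :: "(real \<Rightarrow> complex) \<Rightarrow> real \<Rightarrow> complex" where
  "fourier f t = (CLINT x|lborel. iexp (- (t * x)) * f x)"

text \<open>
  \<open>f\<close> is a version of the inverse transform of \<open>g\<close>. The inverse is determined only up to
  equality almost everywhere, hence a relation rather than a function.
\<close>

definition is_inverse_fourier :: "(real \<Rightarrow> complex) \<Rightarrow> (real \<Rightarrow> complex) \<Rightarrow> bool" where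
  "is_inverse_fourier g f \<longleftrightarrow> integrable lborel f \<and> fourier f = g"

end

theory Submission
  imports Defs
begin

text \<open>
  Weight the law of \<open>Z = compound_sum A Y\<close> by \<open>E = exp (\<eta> * thinned_sum A Y U \<xi>)\<close>. The resulting
  finite measure is absolutely continuous, because every partial sum \<open>Y\<^sub>1 + \<dots> + Y\<^sub>k\<close> with
  \<open>k \<ge> 1\<close> has a density; let \<open>D\<close> be its Radon-Nikodym density. The Fourier transform of \<open>D\<close> at \<open>t\<close>
  is the expectation of \<open>exp (-\<i>tZ) * E\<close>, which is a product of \<open>A\<close> iid factors; conditioning on
  \<open>A\<close> gives \<open>gen_fun M A\<close> at the expectation of a single factor. The ratio condition makes the
  series converge absolutely. Every other inverse transform equals \<open>D\<close> almost everywhere, by the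
  uniqueness theorem for characteristic functions applied to positive and negative parts.
\<close>

section \<open>Injectivity of the Fourier transform on integrable functions\<close>

lemma integrable_iexp_mult:
  assumes "integrable lborel f"
  shows "integrable lborel (\<lambda>x. iexp (- (t * x)) * f x)"
proof (rule Bochner_Integration.integrable_bound)
  show "integrable lborel f" by fact
  then have [measurable]: "f \<in> borel_measurable borel" by simp
  show "(\<lambda>x. iexp (- (t * x)) * f x) \<in> borel_measurable lborel" by measurable
qed (simp add: norm_mult)

lemma fourier_diff:
  assumes "integrable lborel f" "integrable lborel g"
  shows "fourier (\<lambda>x. f x - g x) t = fourier f t - fourier g t"
  unfolding fourier_def right_diff_distrib
  by (rule Bochner_Integration.integral_diff) (intro integrable_iexp_mult assms)+

lemma fourier_cmult: "fourier (\<lambda>x. c * f x) t = c * fourier f t"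
  by (simp add: fourier_def mult.left_commute[of _ c])

lemma fourier_cnj: "fourier (\<lambda>x. cnj (f x)) t = cnj (fourier f (- t))"
proof -
  have "cnj (iexp (t * x)) = iexp (- (t * x))" for x
    by (simp add: exp_cnj)
  then show ?thesis
    by (simp add: fourier_def Bochner_Integration.integral_cnj[symmetric] del: Bochner_Integration.integral_cnj)
qed

text \<open>Equality of the transforms at \<open>0\<close> forces equal total mass \<open>c\<close>.
  If \<open>c = 0\<close>, both functions vanish almost everywhere. Otherwise division by
  \<open>c\<close> gives probability densities with equal characteristic functions, and Levy's
  uniqueness theorem identifies the two laws, hence their densities.\<close>

lemma fourier_inj_nonneg:
  fixes p n :: "real \<Rightarrow> real"
  assumes p: "integrable lborel p" "\<And>x. 0 \<le> p x"
    and n: "integrable lborel n" "\<And>x. 0 \<le> n x"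
    and eq: "fourier (\<lambda>x. complex_of_real (p x)) = fourier (\<lambda>x. complex_of_real (n x))"
  shows "AE x in lborel. p x = n x"
proof -
  have [measurable]: "p \<in> borel_measurable borel" "n \<in> borel_measurable borel"
    using p n by auto
  define c where "c = integral\<^sup>L lborel p"
  have "fourier (\<lambda>x. complex_of_real (f x)) 0 = of_real (integral\<^sup>L lborel f)" for f
    by (simp add: fourier_def)
  then have c: "integral\<^sup>L lborel n = c"
    using fun_cong[OF eq, of 0] by (simp add: c_def)
  have "c \<ge> 0"
    unfolding c_def using p by (intro integral_nonneg_AE) auto
  show ?thesis
  proof (cases "c = 0")
    case True
    have "AE x in lborel. p x = 0" "AE x in lborel. n x = 0"
      using True c p n integral_nonneg_eq_0_iff_AE[of lborel p] integral_nonneg_eq_0_iff_AE[of lborel n]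
      by (simp_all add: c_def)
    then show ?thesis by eventually_elim simp
  next
    case False
    with \<open>c \<ge> 0\<close> have "c > 0" by simp
    have dist: "real_distribution (density lborel (\<lambda>x. ennreal (f x / c)))"
      if f: "integrable lborel f" "\<And>x. 0 \<le> f x" "integral\<^sup>L lborel f = c" for f :: "real \<Rightarrow> real"
    proof -
      have [measurable]: "f \<in> borel_measurable borel" using f by auto
      have "(\<integral>\<^sup>+x. ennreal (f x / c) \<partial>lborel) = ennreal (\<integral>x. f x / c \<partial>lborel)"
        using f \<open>c > 0\<close> by (intro nn_integral_eq_integral) auto
      also have "\<dots> = 1" using f \<open>c > 0\<close> by simp
      finally have "prob_space (density lborel (\<lambda>x. ennreal (f x / c)))"
        by (intro prob_spaceI) (simp add: emeasure_density)
      then show ?thesis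
        by (simp add: real_distribution_def real_distribution_axioms_def)
    qed
    \<comment> \<open>\<open>char\<close> has the phase \<open>iexp (t * x)\<close> without the
      minus sign of \<open>fourier\<close>, hence the argument \<open>- t\<close>.\<close>
    have char: "char (density lborel (\<lambda>x. ennreal (f x / c))) t
        = fourier (\<lambda>x. complex_of_real (f x)) (- t) / c"
      if [measurable]: "f \<in> borel_measurable borel" and f: "\<And>x. 0 \<le> f x" for f :: "real \<Rightarrow> real" and t
    proof -
      have "char (density lborel (\<lambda>x. ennreal (f x / c))) t = (CLINT x|lborel. (f x / c) *\<^sub>R iexp (t * x))"
        unfolding char_def using f \<open>c > 0\<close> by (subst integral_density) auto
      also have "\<dots> = (CLINT x|lborel. (iexp (- ((- t) * x)) * of_real (f x)) / c)"
        by (simp add: scaleR_conv_of_real mult.commute)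
      finally show ?thesis by (simp add: fourier_def)
    qed
    have "density lborel (\<lambda>x. ennreal (p x / c)) = density lborel (\<lambda>x. ennreal (n x / c))"
      using p n c by (intro Levy_uniqueness dist ext) (simp_all add: char eq c_def[symmetric])
    then have "AE x in lborel. ennreal (p x / c) = ennreal (n x / c)"
      by (subst (asm) sigma_finite_measure.density_unique_iff[OF lborel.sigma_finite_measure_axioms]) auto
    then show ?thesis
      by eventually_elim (use p n \<open>c > 0\<close> in \<open>simp add: field_simps\<close>)
  qed
qed

text \<open>The positive and the negative part have equal transforms, so they coincide almost
  everywhere; as at most one of them is nonzero at any point, both vanish there.\<close>

lemma fourier_zero_real:
  fixes f :: "real \<Rightarrow> real"
  assumes f: "integrable lborel f" and zero: "\<And>t. fourier (\<lambda>x. complex_of_real (f x)) t = 0"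
  shows "AE x in lborel. f x = 0"
proof -
  have "fourier (\<lambda>x. complex_of_real (max 0 (f x))) t - fourier (\<lambda>x. complex_of_real (max 0 (- f x))) t = 0" for t
  proof -
    have "(\<lambda>x. complex_of_real (max 0 (f x)) - complex_of_real (max 0 (- f x))) = (\<lambda>x. of_real (f x))"
      by (auto simp: max_def)
    then show ?thesis
      using f zero[of t] by (subst fourier_diff[symmetric]) auto
  qed
  then have "AE x in lborel. max 0 (f x) = max 0 (- f x)"
    using f by (intro fourier_inj_nonneg ext) auto
  then show ?thesis by eventually_elim (auto simp: max_def split: if_splits)
qed

text \<open>Conjugating a function conjugates its transform and reflects the frequency, so a
  vanishing transform passes to the real part and, after multiplication by \<open>- \<i>\<close>, to
  the imaginary part. The real case then covers both.\<close>

lemma fourier_zero: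
  assumes h: "integrable lborel h" and zero: "\<And>t. fourier h t = 0"
  shows "AE x in lborel. h x = 0"
proof -
  have Re_zero: "AE x in lborel. Re (f x) = 0"
    if f: "integrable lborel f" and zero: "\<And>t. fourier f t = 0" for f
  proof (rule fourier_zero_real)
    show "fourier (\<lambda>x. complex_of_real (Re (f x))) t = 0" for t
    proof -
      \<comment> \<open>The average of \<open>f\<close> and its conjugate, with the plus sign hidden
        in the factor \<open>- 1 / 2\<close> so that \<open>fourier_diff\<close> applies.\<close>
      have "(\<lambda>x. complex_of_real (Re (f x))) = (\<lambda>x. (1 / 2) * f x - (- 1 / 2) * cnj (f x))"
        by (simp add: fun_eq_iff complex_eq_iff)
      then show ?thesis
        using f zero by (simp only: fourier_diff fourier_cmult integrable_cnj integrable_mult_right)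
          (simp add: fourier_cnj)
    qed
  qed (use f in simp)
  have "AE x in lborel. Re (h x) = 0"
    using assms by (rule Re_zero)
  moreover have "AE x in lborel. Re (- \<i> * h x) = 0"
    using h zero by (intro Re_zero integrable_mult_right) (simp_all only: fourier_cmult, simp)
  ultimately show ?thesis
    by eventually_elim (simp add: complex_eq_iff)
qed

lemma fourier_inj:
  assumes f: "integrable lborel f" and g: "integrable lborel g" and eq: "fourier f = fourier g"
  shows "AE x in lborel. f x = g x"
proof -
  have "AE x in lborel. f x - g x = 0"
    using f g eq by (intro fourier_zero) (simp_all add: fourier_diff)
  then show ?thesis by simp
qed

text \<open>The strict bound on the \<open>limsup\<close> leaves room for a constant
  \<open>c\<close> with \<open>c * E < 1\<close> that eventually dominates all ratios, so the ratio
  test applies. The resulting convergence later allows the series over the values of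
  \<open>A\<close> to be integrated term by term.\<close>

lemma ratio_condition_summable:
  assumes rc: "ratio_condition \<eta> M A Y" and pos: "0 < integral\<^sup>L M (\<lambda>\<omega>. exp (\<eta> * Y \<omega>))"
  shows "summable (\<lambda>k. weight M A k * integral\<^sup>L M (\<lambda>\<omega>. exp (\<eta> * Y \<omega>)) ^ k)"
proof -
  define E where "E = integral\<^sup>L M (\<lambda>\<omega>. exp (\<eta> * Y \<omega>))"
  have E: "E > 0" using pos by (simp add: E_def)
  have "limsup (\<lambda>k. ereal (weight M A (Suc k)) / ereal (weight M A k)) < ereal (1 / E)"
    using rc E by (simp add: ratio_condition_def E_def one_ereal_def)
  then obtain c where c: "limsup (\<lambda>k. ereal (weight M A (Suc k)) / ereal (weight M A k)) < ereal c" "c < 1 / E"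
    using ereal_dense2 by fastforce
  obtain N where N: "\<And>k. k \<ge> N \<Longrightarrow> ereal (weight M A (Suc k)) / ereal (weight M A k) < ereal c"
    using Limsup_lessD[OF c(1)] by (auto simp: eventually_sequentially)
  have nn: "weight M A k \<ge> 0" for k by (simp add: weight_def)
  have step: "weight M A (Suc k) \<le> c * weight M A k" if "k \<ge> N" for k
  proof (cases "weight M A k = 0")
    case True
    \<comment> \<open>otherwise the ratio would be \<open>\<infinity>\<close>\<close>
    with N[OF that] nn[of "Suc k"] have "weight M A (Suc k) = 0"
      by (cases "weight M A (Suc k) = 0") (auto simp: divide_ereal_def zero_ereal_def[symmetric])
    then show ?thesis using True by simp
  next
    case False
    with nn[of k] have "weight M A k > 0" by simp
    with N[OF that] show ?thesis by (simp add: pos_divide_less_eq)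
  qed
  have "summable (\<lambda>k. weight M A k * E ^ k)"
  proof (rule summable_ratio_test[where c = "c * E" and N = N])
    show "c * E < 1" using c(2) E by (simp add: field_simps)
    fix k assume "k \<ge> N"
    then have "weight M A (Suc k) * (E * E ^ k) \<le> c * weight M A k * (E * E ^ k)"
      using E by (intro mult_right_mono step) auto
    then show "norm (weight M A (Suc k) * E ^ Suc k) \<le> c * E * norm (weight M A k * E ^ k)"
      using E nn by (simp add: abs_mult mult_ac)
  qed
  then show ?thesis by (simp add: E_def)
qed

section \<open>Products of a random number of independent factors\<close>

context prob_space
begin

text \<open>Slot \<open>0\<close> of the family carries \<open>A\<close> and the later slots carry
  the factors, so a single independence hypothesis covers the indicator and the product together,
  and the expectation factorizes. The field is kept general because the result is needed both for
  complex factors and for their real norms.\<close>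

lemma
  fixes W :: "nat \<Rightarrow> 'a \<Rightarrow> 'b::{real_normed_field, banach, second_countable_topology}"
  assumes A[measurable]: "A \<in> measurable M (count_space UNIV)"
    and indep: "indep_vars (\<lambda>_. borel) (\<lambda>j \<omega>. if j = 0 then of_nat (A \<omega>) else W j \<omega>) UNIV"
    and W: "\<And>j. j \<ge> 1 \<Longrightarrow> integrable M (W j)"
  shows integrable_indicator_prod:
      "integrable M (\<lambda>\<omega>. indicator {k} (A \<omega>) * (\<Prod>j = 1..k. W j \<omega>))"
    and expectation_indicator_prod:
      "expectation (\<lambda>\<omega>. indicator {k} (A \<omega>) * (\<Prod>j = 1..k. W j \<omega>))
         = of_real (weight M A k) * (\<Prod>j = 1..k. expectation (W j))"
proof -
  define V where "V j \<omega> = (if j = 0 then indicator {k} (A \<omega>) else W j \<omega>)" for j \<omega>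
  \<comment> \<open>\<open>of_nat\<close> is injective, so the indicator of
    \<open>{of_nat k}\<close> turns the variable in slot \<open>0\<close> into the indicator of the
    event \<open>A = k\<close>; the other slots are left alone.\<close>
  define h :: "nat \<Rightarrow> 'b \<Rightarrow> 'b" where
    "h j = (if j = 0 then indicator {of_nat k} else (\<lambda>x. x))" for j
  have "indep_vars (\<lambda>_. borel) (\<lambda>j \<omega>. h j (if j = 0 then of_nat (A \<omega>) else W j \<omega>)) {0..k}"
    by (rule indep_vars_compose2[OF indep_vars_subset[OF indep]]) (auto simp: h_def)
  moreover have "(\<lambda>j \<omega>. h j (if j = 0 then of_nat (A \<omega>) else W j \<omega>)) = V"
    by (auto simp: fun_eq_iff h_def V_def indicator_def)
  ultimately have indep_V: "indep_vars (\<lambda>_. borel) V {0..k}" by simp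
  have iA_real: "integrable M (\<lambda>\<omega>. indicator {k} (A \<omega>) :: real)"
    by (intro integrable_const_bound[where B = 1]) (auto simp: indicator_def)
  then have iA: "integrable M (\<lambda>\<omega>. of_real (indicator {k} (A \<omega>)) :: 'b)"
    by (rule integrable_of_real)
  have "expectation (\<lambda>\<omega>. indicator {k} (A \<omega>)) = (\<integral>\<omega>. indicator {\<omega> \<in> space M. A \<omega> = k} \<omega> \<partial>M)"
    by (intro Bochner_Integration.integral_cong) (auto simp: indicator_def)
  also have "\<dots> = weight M A k" by (simp add: weight_def)
  finally have eA: "expectation (\<lambda>\<omega>. of_real (indicator {k} (A \<omega>)) :: 'b) = of_real (weight M A k)"
    
    by (subst integral_bounded_linear[OF bounded_linear_of_real]) (simp_all add: iA_real)
  have V0: "V 0 = (\<lambda>\<omega>. of_real (indicator {k} (A \<omega>)))"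
    by (auto simp: V_def indicator_def)
  have VS: "V j = W j" if "j \<ge> 1" for j
    using that by (auto simp: V_def)
  have int_V: "integrable M (V j)" for j
    using W[of j] iA by (cases "j \<ge> 1") (auto simp: VS V0 not_le)
  have prod: "(\<Prod>j = 0..k. f (V j)) = f (V 0) * (\<Prod>j = 1..k. f (W j))" for f :: "('a \<Rightarrow> 'b) \<Rightarrow> 'b"
    by (simp add: prod.atLeast_Suc_atMost VS)
  have eq: "(\<lambda>\<omega>. indicator {k} (A \<omega>) * (\<Prod>j = 1..k. W j \<omega>)) = (\<lambda>\<omega>. \<Prod>j = 0..k. V j \<omega>)"
    using prod[of "\<lambda>v. v _"] by (auto simp: V0 fun_eq_iff indicator_def)
  show "integrable M (\<lambda>\<omega>. indicator {k} (A \<omega>) * (\<Prod>j = 1..k. W j \<omega>))"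
    unfolding eq by (intro indep_vars_integrable indep_V int_V) simp
  have "expectation (\<lambda>\<omega>. indicator {k} (A \<omega>) * (\<Prod>j = 1..k. W j \<omega>)) = (\<Prod>j = 0..k. expectation (V j))"
    unfolding eq by (intro indep_vars_lebesgue_integral indep_V int_V) simp
  also have "\<dots> = expectation (V 0) * (\<Prod>j = 1..k. expectation (W j))"
    by (rule prod)
  also have "expectation (V 0) = of_real (weight M A k)"
    unfolding V0 by (rule eA)
  finally show "expectation (\<lambda>\<omega>. indicator {k} (A \<omega>) * (\<Prod>j = 1..k. W j \<omega>))
         = of_real (weight M A k) * (\<Prod>j = 1..k. expectation (W j))" .
qed

text \<open>Splitting by the value of \<open>A\<close> writes the product as a series with a single
  nonzero index at each point. The expected norms of its terms are dominated through
  \<open>b\<close> by a summable sequence, which justifies integration term by term.\<close>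

lemma
  fixes W :: "nat \<Rightarrow> 'a \<Rightarrow> complex"
  assumes A[measurable]: "A \<in> measurable M (count_space UNIV)"
    and A1: "\<And>\<omega>. \<omega> \<in> space M \<Longrightarrow> A \<omega> \<ge> 1"
    and indep: "indep_vars (\<lambda>_. borel) (\<lambda>j \<omega>. if j = 0 then of_nat (A \<omega>) else W j \<omega>) UNIV"
    and W: "\<And>j. j \<ge> 1 \<Longrightarrow> integrable M (W j)"
    and w: "\<And>j. j \<ge> 1 \<Longrightarrow> expectation (W j) = w"
    and b: "\<And>j. j \<ge> 1 \<Longrightarrow> expectation (\<lambda>\<omega>. norm (W j \<omega>)) \<le> b"
    and summable: "summable (\<lambda>k. weight M A k * b ^ k)"
  shows integrable_random_prod: "integrable M (\<lambda>\<omega>. \<Prod>j = 1..A \<omega>. W j \<omega>)"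
    and expectation_random_prod: "expectation (\<lambda>\<omega>. \<Prod>j = 1..A \<omega>. W j \<omega>) = gen_fun M A w"
proof -
  \<comment> \<open>Since \<open>A\<close> is at least \<open>1\<close>, the values of
    \<open>A\<close> are enumerated as \<open>Suc k\<close>, which matches the indexing in
    \<open>gen_fun\<close>.\<close>
  define f where "f k \<omega> = indicator {Suc k} (A \<omega>) * (\<Prod>j = 1..Suc k. W j \<omega>)" for k \<omega>
  have f: "integrable M (f k)" for k
    unfolding f_def by (rule integrable_indicator_prod[OF A indep W])
  have ef: "expectation (f k) = of_real (weight M A (Suc k)) * w ^ Suc k" for k
    unfolding f_def by (subst expectation_indicator_prod[OF A indep W]) (simp_all add: w)
  \<comment> \<open>The norm of the complex \<open>of_nat\<close> is the real \<open>of_nat\<close>,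
    so the norms form a family of the same shape and \<open>expectation_indicator_prod\<close>
    applies to them too.\<close>
  have "indep_vars (\<lambda>_. borel) (\<lambda>j \<omega>. norm (if j = 0 then of_nat (A \<omega>) else W j \<omega>)) UNIV"
    by (rule indep_vars_compose2[OF indep]) simp
  then have indep_norm: "indep_vars (\<lambda>_. borel) (\<lambda>j \<omega>. if j = 0 then of_nat (A \<omega>) else norm (W j \<omega>)) UNIV"
    by (simp add: if_distrib[of norm] cong: if_cong)
  have enf: "expectation (\<lambda>\<omega>. norm (f k \<omega>)) \<le> weight M A (Suc k) * b ^ Suc k" for k
  proof -
    have "expectation (\<lambda>\<omega>. norm (f k \<omega>))
        = expectation (\<lambda>\<omega>. indicator {Suc k} (A \<omega>) * (\<Prod>j = 1..Suc k. norm (W j \<omega>)))"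
      unfolding f_def norm_mult prod_norm
      by (intro Bochner_Integration.integral_cong refl arg_cong2[where f = "(*)"]) (simp add: indicator_def)
    also have "\<dots> = weight M A (Suc k) * (\<Prod>j = 1..Suc k. expectation (\<lambda>\<omega>. norm (W j \<omega>)))"
      using W by (subst expectation_indicator_prod[OF A indep_norm]) auto
    also have "\<dots> \<le> weight M A (Suc k) * (\<Prod>j = 1..Suc k. b)"
      by (intro mult_left_mono prod_mono) (auto simp: weight_def b integral_nonneg_AE)
    finally show ?thesis by simp
  qed
  have sum_f: "(\<lambda>k. f k \<omega>) sums (\<Prod>j = 1..A \<omega>. W j \<omega>)" if "\<omega> \<in> space M" for \<omega>
  proof -
    \<comment> \<open>Only the index \<open>A \<omega> - 1\<close> can contribute; truncated
      subtraction is harmless because \<open>A \<omega> \<ge> 1\<close>.\<close>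
    have "(\<lambda>k. f k \<omega>) sums (\<Sum>k\<in>{A \<omega> - 1}. f k \<omega>)"
      using A1[OF that] by (intro sums_finite) (auto simp: f_def indicator_def)
    then show ?thesis
      using A1[OF that] by (simp add: f_def del: prod.cl_ivl_Suc)
  qed
  have "summable (\<lambda>k. norm (f k \<omega>))" for \<omega>
    by (rule summable_finite[of "{A \<omega> - 1}"]) (auto simp: f_def indicator_def)
  then have sf: "AE \<omega> in M. summable (\<lambda>k. norm (f k \<omega>))" by simp
  have sef: "summable (\<lambda>k. expectation (\<lambda>\<omega>. norm (f k \<omega>)))"
  proof (rule summable_comparison_test')
    show "summable (\<lambda>k. weight M A (Suc k) * b ^ Suc k)"
      using summable by (subst summable_Suc_iff)
  qed (use enf in \<open>auto simp: integral_nonneg_AE simp del: power_Suc\<close>)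
  have eq: "(\<Prod>j = 1..A \<omega>. W j \<omega>) = (\<Sum>k. f k \<omega>)" if "\<omega> \<in> space M" for \<omega>
    using sum_f[OF that] by (rule sums_unique)
  show "integrable M (\<lambda>\<omega>. \<Prod>j = 1..A \<omega>. W j \<omega>)"
    by (subst Bochner_Integration.integrable_cong[OF refl eq]) (use integrable_suminf[OF f sf sef] in simp_all)
  have "expectation (\<lambda>\<omega>. \<Prod>j = 1..A \<omega>. W j \<omega>) = expectation (\<lambda>\<omega>. \<Sum>k. f k \<omega>)"
    by (intro Bochner_Integration.integral_cong refl eq)
  also have "\<dots> = (\<Sum>k. expectation (f k))"
    by (rule integral_suminf[OF f sf sef])
  finally show "expectation (\<lambda>\<omega>. \<Prod>j = 1..A \<omega>. W j \<omega>) = gen_fun M A w"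
    by (simp only: ef gen_fun_def)
qed

section \<open>The Fourier transform of a single thinned summand\<close>

text \<open>The exponential weight is switched on exactly when \<open>U\<close> is at most
  \<open>\<xi>\<close>, an event of probability \<open>\<xi>\<close> independent of
  \<open>Y\<close>. Averaging over \<open>U\<close> therefore mixes the tilted density and
  \<open>\<mu>\<close> in the proportions \<open>\<xi>\<close> and \<open>1 - \<xi>\<close>.\<close>

lemma
  assumes indep: "indep_var borel Y borel U"
    and Y: "distributed M lborel Y (\<lambda>z. ennreal (\<mu> z))" and \<mu>: "\<And>z. \<mu> z \<ge> 0"
    and U: "distr M borel U = uniform_measure lborel {0..1::real}"
    and exp: "integrable M (\<lambda>\<omega>. exp (\<eta> * Y \<omega>))"
    and \<xi>: "0 \<le> \<xi>" "\<xi> \<le> 1"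
  shows integrable_thinned_summand:
      "integrable M (\<lambda>\<omega>. iexp (- (t * Y \<omega>)) * complex_of_real (exp (\<eta> * (Y \<omega> * indicator {..\<xi>} (U \<omega>)))))"
    and expectation_thinned_summand:
      "expectation (\<lambda>\<omega>. iexp (- (t * Y \<omega>)) * complex_of_real (exp (\<eta> * (Y \<omega> * indicator {..\<xi>} (U \<omega>)))))
         = fourier (\<lambda>z. complex_of_real (\<xi> * (exp (\<eta> * z) * \<mu> z) + (1 - \<xi>) * \<mu> z)) t"
proof -
  have [measurable]: "Y \<in> borel_measurable M" "U \<in> borel_measurable M"
    using indep_var_rv1[OF indep] indep_var_rv2[OF indep] by auto
  \<comment> \<open>What \<open>Y\<close> provides directly is measurability of the composition with
    \<open>ennreal\<close>; nonnegativity lets \<open>enn2real\<close> undo it.\<close>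
  have "(\<lambda>z. enn2real (ennreal (\<mu> z))) \<in> borel_measurable lborel"
    using distributed_borel_measurable[OF Y] by measurable
  then have [measurable]: "\<mu> \<in> borel_measurable borel" using \<mu> by simp
  have dY: "distr M lborel Y = density lborel (\<lambda>z. ennreal (\<mu> z))"
    using Y by (simp add: distributed_def)
  have to_Y: "integrable M (\<lambda>\<omega>. h (Y \<omega>)) \<longleftrightarrow> integrable lborel (\<lambda>z. \<mu> z *\<^sub>R h z)"
    "expectation (\<lambda>\<omega>. h (Y \<omega>)) = (\<integral>z. \<mu> z *\<^sub>R h z \<partial>lborel)"
    if [measurable]: "h \<in> borel_measurable borel" for h :: "real \<Rightarrow> complex"
  proof -
    have "integrable M (\<lambda>\<omega>. h (Y \<omega>)) \<longleftrightarrow> integrable (distr M lborel Y) h"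
      by (subst integrable_distr_eq) auto
    then show "integrable M (\<lambda>\<omega>. h (Y \<omega>)) \<longleftrightarrow> integrable lborel (\<lambda>z. \<mu> z *\<^sub>R h z)"
      unfolding dY using \<mu> by (subst (asm) integrable_density) auto
    have "expectation (\<lambda>\<omega>. h (Y \<omega>)) = integral\<^sup>L (distr M lborel Y) h"
      by (subst integral_distr) auto
    then show "expectation (\<lambda>\<omega>. h (Y \<omega>)) = (\<integral>z. \<mu> z *\<^sub>R h z \<partial>lborel)"
      unfolding dY using \<mu> by (subst (asm) integral_density) auto
  qed
  define e1 e2 where "e1 y = iexp (- (t * y)) * complex_of_real (exp (\<eta> * y))"
    and "e2 y = iexp (- (t * y))" for y
  have [measurable]: "e1 \<in> borel_measurable borel" "e2 \<in> borel_measurable borel"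
    unfolding e1_def[abs_def] e2_def[abs_def] by measurable
  \<comment> \<open>The phase has modulus one, so the norm of \<open>e1 (Y \<omega>)\<close> is
    exactly \<open>exp (\<eta> * Y \<omega>)\<close>.\<close>
  have ie1: "integrable M (\<lambda>\<omega>. e1 (Y \<omega>))"
    by (rule Bochner_Integration.integrable_bound[OF exp]) (auto simp: e1_def norm_mult)
  have ie2: "integrable M (\<lambda>\<omega>. e2 (Y \<omega>))"
    by (rule integrable_const_bound[where B = 1]) (auto simp: e2_def)
  define i1 i2 :: "real \<Rightarrow> complex" where "i1 = indicator {..\<xi>}" and "i2 = indicator {\<xi><..}"
  have [measurable]: "i1 \<in> borel_measurable borel" "i2 \<in> borel_measurable borel"
    unfolding i1_def i2_def by measurable
  have ii: "integrable M (\<lambda>\<omega>. i1 (U \<omega>))" "integrable M (\<lambda>\<omega>. i2 (U \<omega>))"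
    by (rule integrable_const_bound[where B = 1]; auto simp: i1_def i2_def indicator_def)+
  have ind: "indep_var borel (\<lambda>\<omega>. e (Y \<omega>)) borel (\<lambda>\<omega>. i (U \<omega>))"
    if "e \<in> borel_measurable borel" "i \<in> borel_measurable borel" for e i :: "real \<Rightarrow> complex"
    using indep_var_compose[OF indep that] by (simp add: comp_def)
  have prob_U: "prob (U -` S \<inter> space M) = measure lborel ({0..1} \<inter> S)" if [measurable]: "S \<in> sets borel" for S
  proof -
    have "prob (U -` S \<inter> space M) = measure (distr M borel U) S"
      by (simp add: measure_distr)
    then show ?thesis unfolding U by simp
  qed
  have "{0..1} \<inter> {..\<xi>} = {0..\<xi>}" "{0..1} \<inter> {\<xi><..} = {\<xi><..1}" using \<xi> by auto
  then have pU: "prob (U -` {..\<xi>} \<inter> space M) = \<xi>" "prob (U -` {\<xi><..} \<inter> space M) = 1 - \<xi>"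
    using \<xi> by (simp_all add: prob_U)
  have eU: "expectation (\<lambda>\<omega>. indicator S (U \<omega>) :: complex) = of_real (prob (U -` S \<inter> space M))"
    if [measurable]: "S \<in> sets borel" for S
  proof -
    have "expectation (\<lambda>\<omega>. indicator S (U \<omega>) :: complex)
        = expectation (\<lambda>\<omega>. complex_of_real (indicator (U -` S \<inter> space M) \<omega>))"
      by (intro Bochner_Integration.integral_cong) (auto simp: indicator_def)
    then show ?thesis by (simp add: Int_commute)
  qed
  have ei: "expectation (\<lambda>\<omega>. i1 (U \<omega>)) = of_real \<xi>" "expectation (\<lambda>\<omega>. i2 (U \<omega>)) = of_real (1 - \<xi>)"
    unfolding i1_def i2_def by (simp_all add: eU pU)
  \<comment> \<open>At each point exactly one of the two indicators is \<open>1\<close>; where it is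
    \<open>i2\<close>, the exponent is \<open>0\<close> and only the phase remains.\<close>
  have split: "(\<lambda>\<omega>. iexp (- (t * Y \<omega>)) * complex_of_real (exp (\<eta> * (Y \<omega> * indicator {..\<xi>} (U \<omega>)))))
      = (\<lambda>\<omega>. e1 (Y \<omega>) * i1 (U \<omega>) + e2 (Y \<omega>) * i2 (U \<omega>))"
    by (auto simp: fun_eq_iff e1_def e2_def i1_def i2_def indicator_def)
  have int1: "integrable M (\<lambda>\<omega>. e1 (Y \<omega>) * i1 (U \<omega>))"
    by (intro indep_var_integrable ind ie1 ii) auto
  have int2: "integrable M (\<lambda>\<omega>. e2 (Y \<omega>) * i2 (U \<omega>))"
    by (intro indep_var_integrable ind ie2 ii) auto
  show "integrable M (\<lambda>\<omega>. iexp (- (t * Y \<omega>)) * complex_of_real (exp (\<eta> * (Y \<omega> * indicator {..\<xi>} (U \<omega>)))))"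
    unfolding split using int1 int2 by simp
  have "expectation (\<lambda>\<omega>. e1 (Y \<omega>) * i1 (U \<omega>) + e2 (Y \<omega>) * i2 (U \<omega>))
      = expectation (\<lambda>\<omega>. e1 (Y \<omega>)) * of_real \<xi> + expectation (\<lambda>\<omega>. e2 (Y \<omega>)) * of_real (1 - \<xi>)"
    using int1 int2 indep_var_lebesgue_integral[OF ind[of e1 i1] ie1 ii(1)]
      indep_var_lebesgue_integral[OF ind[of e2 i2] ie2 ii(2)] by (simp add: ei)
  also have "\<dots> = (CLINT z|lborel. \<mu> z *\<^sub>R e1 z) * of_real \<xi> + (CLINT z|lborel. \<mu> z *\<^sub>R e2 z) * of_real (1 - \<xi>)"
    by (simp add: to_Y)
  also have "\<dots> = (CLINT z|lborel. \<mu> z *\<^sub>R e1 z * of_real \<xi> + \<mu> z *\<^sub>R e2 z * of_real (1 - \<xi>))"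
    using ie1 ie2 unfolding to_Y(1)[OF \<open>e1 \<in> borel_measurable borel\<close>] to_Y(1)[OF \<open>e2 \<in> borel_measurable borel\<close>]
    by (subst Bochner_Integration.integral_add) (simp_all del: of_real_diff mult_scaleR_left)
  also have "\<dots> = fourier (\<lambda>z. complex_of_real (\<xi> * (exp (\<eta> * z) * \<mu> z) + (1 - \<xi>) * \<mu> z)) t"
    unfolding fourier_def
    by (intro Bochner_Integration.integral_cong) (auto simp: e1_def e2_def scaleR_conv_of_real algebra_simps simp flip: exp_of_real)
  finally show "expectation (\<lambda>\<omega>. iexp (- (t * Y \<omega>)) * complex_of_real (exp (\<eta> * (Y \<omega> * indicator {..\<xi>} (U \<omega>)))))
         = fourier (\<lambda>z. complex_of_real (\<xi> * (exp (\<eta> * z) * \<mu> z) + (1 - \<xi>) * \<mu> z)) t"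
    unfolding split .
qed

section \<open>Absolute continuity of the compound sum and of its weighted law\<close>

text \<open>Adding one more independent summand convolves the densities. The induction starts at
  \<open>k = 1\<close>, since the empty sum is a point mass at \<open>0\<close> and has no
  density.\<close>

lemma distributed_partial_sum:
  fixes Y :: "nat \<Rightarrow> 'a \<Rightarrow> real"
  assumes indep: "indep_vars (\<lambda>_. borel) Y {1..}"
    and Y: "\<And>j. j \<ge> 1 \<Longrightarrow> distributed M lborel (Y j) f" and k: "k \<ge> 1"
  shows "\<exists>g. distributed M lborel (\<lambda>\<omega>. \<Sum>j = 1..k. Y j \<omega>) g"
  using k
proof (induction k rule: nat_induct_at_least)
  case base
  then show ?case using Y[of 1] by auto
next
  case (Suc k)
  then obtain g where g: "distributed M lborel (\<lambda>\<omega>. \<Sum>j = 1..k. Y j \<omega>) g" by blast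
  have "indep_var borel (Y (Suc k)) borel (\<lambda>\<omega>. \<Sum>j\<in>{1..k}. Y j \<omega>)"
    by (rule indep_vars_sum) (auto intro: indep_vars_subset[OF indep])
  from distributed_convolution[OF this Y g] show ?case
    by (auto simp: add.commute)
qed

text \<open>For each fixed length the exceptional event is null because the partial sum has a
  density, and the union over countably many lengths stays null. The bound
  \<open>A \<omega> \<ge> 1\<close> rules out the empty sum.\<close>

lemma AE_compound_sum:
  fixes Y :: "nat \<Rightarrow> 'a \<Rightarrow> real"
  assumes A1: "\<And>\<omega>. \<omega> \<in> space M \<Longrightarrow> A \<omega> \<ge> 1"
    and indep: "indep_vars (\<lambda>_. borel) Y {1..}"
    and Y: "\<And>j. j \<ge> 1 \<Longrightarrow> distributed M lborel (Y j) f"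
    and P: "AE x in lborel. P x"
  shows "AE \<omega> in M. P (compound_sum A Y \<omega>)"
proof -
  have "AE \<omega> in M. P (\<Sum>j = 1..k. Y j \<omega>)" if "k \<ge> 1" for k
  proof -
    obtain g where g: "distributed M lborel (\<lambda>\<omega>. \<Sum>j = 1..k. Y j \<omega>) g"
      using distributed_partial_sum[OF indep Y \<open>k \<ge> 1\<close>] by blast
    have "AE x in distr M lborel (\<lambda>\<omega>. \<Sum>j = 1..k. Y j \<omega>). P x"
      unfolding distributed_distr_eq_density[OF g]
      using P distributed_borel_measurable[OF g] by (auto simp: AE_density elim: eventually_mono)
    then show ?thesis
      by (rule AE_distrD[OF distributed_measurable[OF g]])
  qed
  then have "AE \<omega> in M. \<forall>k. k \<ge> 1 \<longrightarrow> P (\<Sum>j = 1..k. Y j \<omega>)"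
    by (simp add: AE_all_countable)
  then show ?thesis
    using AE_space by eventually_elim (use A1 in \<open>simp add: compound_sum_def\<close>)
qed

text \<open>The measure with density \<open>E\<close>, pushed forward along \<open>Z\<close>, is
  absolutely continuous by \<open>null\<close>, and \<open>D\<close> is its Radon-Nikodym
  derivative. The transfer rules admit arbitrary Borel test functions, so they serve both for the
  oscillating phases and for the bounded function of the theorem.\<close>

lemma weighted_law_density:
  fixes Z E :: "'a \<Rightarrow> real"
  assumes Z[measurable]: "Z \<in> borel_measurable M"
    and E: "integrable M E" and E_nonneg: "\<And>\<omega>. 0 \<le> E \<omega>"
    and null: "\<And>P. AE x in lborel. P x \<Longrightarrow> AE \<omega> in M. P (Z \<omega>)"
  obtains D :: "real \<Rightarrow> real" where "D \<in> borel_measurable borel" "\<And>x. 0 \<le> D x"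
    "\<And>F :: real \<Rightarrow> complex. F \<in> borel_measurable borel \<Longrightarrow>
       integrable lborel (\<lambda>x. D x *\<^sub>R F x) \<longleftrightarrow> integrable M (\<lambda>\<omega>. E \<omega> *\<^sub>R F (Z \<omega>))"
    "\<And>F :: real \<Rightarrow> complex. F \<in> borel_measurable borel \<Longrightarrow>
       (\<integral>x. D x *\<^sub>R F x \<partial>lborel) = expectation (\<lambda>\<omega>. E \<omega> *\<^sub>R F (Z \<omega>))"
proof -
  have [measurable]: "E \<in> borel_measurable M" using E by simp
  define N where "N = distr (density M (\<lambda>\<omega>. ennreal (E \<omega>))) lborel Z"
  have sets_N: "sets N = sets lborel" by (simp add: N_def)
  \<comment> \<open>The total mass is the expectation of \<open>E\<close>; its finiteness is what
    yields a real-valued derivative below.\<close>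
  have "emeasure (density M (\<lambda>\<omega>. ennreal (E \<omega>))) (space M) = ennreal (expectation E)"
    using E E_nonneg by (simp add: emeasure_density nn_integral_eq_integral cong: nn_integral_cong)
  then have "finite_measure (density M (\<lambda>\<omega>. ennreal (E \<omega>)))"
    by (intro finite_measureI) simp
  then have fin: "finite_measure N"
    unfolding N_def by (rule finite_measure.finite_measure_distr) simp
  have ac: "absolutely_continuous lborel N"
    unfolding absolutely_continuous_def
  proof
    fix S :: "real set" assume S: "S \<in> null_sets lborel"
    then have [measurable]: "S \<in> sets borel" by (auto dest: null_setsD2)
    have "AE \<omega> in M. Z \<omega> \<notin> S"
      by (intro null AE_not_in S)
    then have "AE x in N. x \<notin> S"
      unfolding N_def by (subst AE_distr_iff) (auto simp: AE_density)
    then show "S \<in> null_sets N"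
      by (subst AE_iff_null_sets) (simp_all add: sets_N)
  qed
  obtain D where D: "D \<in> borel_measurable lborel" "\<And>x. 0 \<le> D x"
    "AE x in lborel. RN_deriv lborel N x = ennreal (D x)"
    by (rule sigma_finite_measure.real_RN_deriv[OF lborel.sigma_finite_measure_axioms fin ac sets_N]) blast
  then have [measurable]: "D \<in> borel_measurable borel" by simp
  have "N = density lborel (RN_deriv lborel N)"
    by (rule sigma_finite_measure.density_RN_deriv[OF lborel.sigma_finite_measure_axioms ac sets_N, symmetric])
  also have "\<dots> = density lborel (\<lambda>x. ennreal (D x))"
    using D by (intro density_cong) auto
  finally have N_D: "N = density lborel (\<lambda>x. ennreal (D x))" .
  show thesis
  proof (rule that)
    fix F :: "real \<Rightarrow> complex" assume [measurable]: "F \<in> borel_measurable borel"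
    have "integrable lborel (\<lambda>x. D x *\<^sub>R F x) \<longleftrightarrow> integrable N F"
      unfolding N_D using D(2) by (subst integrable_density) auto
    also have "\<dots> \<longleftrightarrow> integrable M (\<lambda>\<omega>. E \<omega> *\<^sub>R F (Z \<omega>))"
      unfolding N_def using E_nonneg by (subst integrable_distr_eq) (auto simp: integrable_density)
    finally show "integrable lborel (\<lambda>x. D x *\<^sub>R F x) \<longleftrightarrow> integrable M (\<lambda>\<omega>. E \<omega> *\<^sub>R F (Z \<omega>))" .
    have "(\<integral>x. D x *\<^sub>R F x \<partial>lborel) = integral\<^sup>L N F"
      unfolding N_D using D(2) by (subst integral_density) auto
    also have "\<dots> = expectation (\<lambda>\<omega>. E \<omega> *\<^sub>R F (Z \<omega>))"
      unfolding N_def using E_nonneg by (subst integral_distr) (auto simp: integral_density)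
    finally show "(\<integral>x. D x *\<^sub>R F x \<partial>lborel) = expectation (\<lambda>\<omega>. E \<omega> *\<^sub>R F (Z \<omega>))" .
  qed (use D in auto)
qed

end

section \<open>The transform of the weighted law and the integral formula\<close>

theorem lemma4p1:
  fixes M :: "'a measure"
    and A :: "'a \<Rightarrow> nat"
    and Y U :: "nat \<Rightarrow> 'a \<Rightarrow> real"
    and \<mu> \<sigma> :: "real \<Rightarrow> real"
    and \<eta> \<xi> :: real
  assumes "prob_space M"
    and "\<eta> > 0"
    and "A \<in> measurable M (count_space UNIV)"
    and "\<And>\<omega>. \<omega> \<in> space M \<Longrightarrow> A \<omega> \<ge> 1"
    and "\<And>j. j \<ge> 1 \<Longrightarrow> Y j \<in> borel_measurable M"
    and "\<And>j \<omega>. j \<ge> 1 \<Longrightarrow> \<omega> \<in> space M \<Longrightarrow> Y j \<omega> \<ge> 0"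
    and "\<And>j. j \<ge> 1 \<Longrightarrow> distr M borel (Y j) = distr M borel (Y 1)"
    and "\<And>j. j \<ge> 1 \<Longrightarrow> U j \<in> borel_measurable M"
    and "\<And>j. j \<ge> 1 \<Longrightarrow> distr M borel (U j) = uniform_measure lborel {0..1}"
    \<comment> \<open>mutual independence of the whole family \<open>A, Y\<^sub>1, Y\<^sub>2, \<dots>, U\<^sub>1, U\<^sub>2, \<dots>\<close>\<close>
    and "prob_space.indep_vars M (\<lambda>_. borel)
           (case_sum (\<lambda>_::unit. \<lambda>\<omega>. real (A \<omega>)) (case_sum Y U)) ({()} <+> ({1..} <+> {1..}))"
    and "ratio_condition \<eta> M A (Y 1)"
    and "\<And>z. \<mu> z \<ge> 0"
    and "\<And>z. z < 0 \<Longrightarrow> \<mu> z = 0"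
    and "piecewise_continuous_halfline \<mu>"
    and "distributed M lborel (Y 1) (\<lambda>z. ennreal (\<mu> z))"
    and "\<sigma> \<in> borel_measurable (restrict_space borel {0..})"
    and "bounded (\<sigma> ` {0..})"
    and "0 \<le> \<xi>" and "\<xi> \<le> 1"
  shows "let \<mu>' = (\<lambda>z. exp (\<eta> * z) * \<mu> z);
             g = (\<lambda>t. gen_fun M A
                    (fourier (\<lambda>z. complex_of_real (\<xi> * \<mu>' z + (1 - \<xi>) * \<mu> z)) t));
             X = (\<lambda>\<omega>. \<sigma> (compound_sum A Y \<omega>) * exp (\<eta> * thinned_sum A Y U \<xi> \<omega>))
         in integrable M X \<and>
            (\<exists>\<mu>\<^sub>\<xi>. is_inverse_fourier g \<mu>\<^sub>\<xi>) \<and>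
            (\<forall>\<mu>\<^sub>\<xi>. is_inverse_fourier g \<mu>\<^sub>\<xi> \<longrightarrow>
               complex_of_real (integral\<^sup>L M X)
                 = (CLINT z:{0..}|lborel. complex_of_real (\<sigma> z) * \<mu>\<^sub>\<xi> z))"
proof -
  define \<mu>' where "\<mu>' = (\<lambda>z. exp (\<eta> * z) * \<mu> z)"
  define g where "g = (\<lambda>t. gen_fun M A (fourier (\<lambda>z. complex_of_real (\<xi> * \<mu>' z + (1 - \<xi>) * \<mu> z)) t))"
  define E where "E \<omega> = exp (\<eta> * thinned_sum A Y U \<xi> \<omega>)" for \<omega>
  define Z where "Z = compound_sum A Y"
  define X where "X = (\<lambda>\<omega>. \<sigma> (Z \<omega>) * E \<omega>)"
  interpret prob_space M by fact
  note A = assms(3) and A1 = assms(4) and Y_meas = assms(5) and Y_nonneg = assms(6)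
    and Y_distr = assms(7) and U_distr = assms(9) and indep = assms(10)
    and rc = assms(11) and \<mu>_nonneg = assms(12) and Y1 = assms(15) and \<sigma>_meas = assms(16)
    and \<sigma>_bounded = assms(17) and \<xi> = assms(18,19)

  have exp_int: "integrable M (\<lambda>\<omega>. exp (\<eta> * Y j \<omega>))"
    and exp_eq: "expectation (\<lambda>\<omega>. exp (\<eta> * Y j \<omega>)) = expectation (\<lambda>\<omega>. exp (\<eta> * Y 1 \<omega>))"
    and Y_dens: "distributed M lborel (Y j) (\<lambda>z. ennreal (\<mu> z))" if "j \<ge> 1" for j
  proof -
    have [measurable]: "Y j \<in> borel_measurable M" "Y 1 \<in> borel_measurable M"
      using Y_meas that by auto
    have "integrable M (\<lambda>\<omega>. exp (\<eta> * Y 1 \<omega>))"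
      using rc by (simp add: ratio_condition_def)
    then have "integrable (distr M borel (Y 1)) (\<lambda>y. exp (\<eta> * y))"
      by (simp add: integrable_distr_eq del: One_nat_def)
    then show "integrable M (\<lambda>\<omega>. exp (\<eta> * Y j \<omega>))"
      unfolding Y_distr[OF that, symmetric] by (simp add: integrable_distr_eq)
    have "expectation (\<lambda>\<omega>. exp (\<eta> * Y j \<omega>)) = (\<integral>y. exp (\<eta> * y) \<partial>distr M borel (Y j))"
      by (simp add: integral_distr)
    also have "\<dots> = expectation (\<lambda>\<omega>. exp (\<eta> * Y 1 \<omega>))"
      unfolding Y_distr[OF that] by (simp add: integral_distr del: One_nat_def)
    finally show "expectation (\<lambda>\<omega>. exp (\<eta> * Y j \<omega>)) = expectation (\<lambda>\<omega>. exp (\<eta> * Y 1 \<omega>))" .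
    \<comment> \<open>\<open>borel\<close> and \<open>lborel\<close> share their measurable sets,
      and \<open>distr\<close> depends on its target only through space and measurable sets.\<close>
    have "distr M lborel (Y j) = distr M borel (Y j)" "distr M lborel (Y 1) = distr M borel (Y 1)"
      by (auto intro!: distr_cong)
    then show "distributed M lborel (Y j) (\<lambda>z. ennreal (\<mu> z))"
      using Y1 Y_distr[OF that] by (simp add: distributed_def)
  qed

  have indep_Y: "indep_vars (\<lambda>_. borel) Y {1..}"
  proof -
    \<comment> \<open>The joint family is cut into disjoint singleton blocks, and each block is then
      evaluated at its only index.\<close>
    have "indep_vars (\<lambda>j. PiM {Inr (Inl j)} (\<lambda>_. borel)) (\<lambda>j \<omega>. restrict (\<lambda>i.
        case_sum (\<lambda>_::unit. \<lambda>\<omega>. real (A \<omega>)) (case_sum Y U) i \<omega>) {Inr (Inl j)}) {1..}"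
      by (rule indep_vars_restrict[OF indep]) (auto simp: disjoint_family_on_def)
    then have "indep_vars (\<lambda>_. borel) (\<lambda>j \<omega>. (\<lambda>f. f (Inr (Inl j))) (restrict (\<lambda>i.
        case_sum (\<lambda>_::unit. \<lambda>\<omega>. real (A \<omega>)) (case_sum Y U) i \<omega>) {Inr (Inl j)})) {1..}"
      by (rule indep_vars_compose2) simp
    then show ?thesis by simp
  qed
  have indep_YU: "indep_var borel (Y j) borel (U j)" if "j \<ge> 1" for j
  proof -
    have "indep_var borel ((\<lambda>f. f (Inr (Inl j))) \<circ> (\<lambda>\<omega>. restrict (\<lambda>i.
          case_sum (\<lambda>_::unit. \<lambda>\<omega>. real (A \<omega>)) (case_sum Y U) i \<omega>) {Inr (Inl j)}))
        borel ((\<lambda>f. f (Inr (Inr j))) \<circ> (\<lambda>\<omega>. restrict (\<lambda>i.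
          case_sum (\<lambda>_::unit. \<lambda>\<omega>. real (A \<omega>)) (case_sum Y U) i \<omega>) {Inr (Inr j)}))"
      using that by (intro indep_var_compose[OF indep_var_restrict[OF indep]]) auto
    then show ?thesis by (simp add: comp_def)
  qed

  define W where
    "W t j \<omega> = iexp (- (t * Y j \<omega>)) * complex_of_real (exp (\<eta> * (Y j \<omega> * indicator {..\<xi>} (U j \<omega>))))"
    for t :: real and j \<omega>
  have indep_W: "indep_vars (\<lambda>_. borel) (\<lambda>j \<omega>. if j = 0 then of_nat (A \<omega>) else W t j \<omega>) UNIV" for t
  proof -
    \<comment> \<open>Block \<open>0\<close> contains \<open>A\<close> alone and block
      \<open>j \<ge> 1\<close> pairs \<open>Y j\<close> with \<open>U j\<close>; functions of
      disjoint blocks are independent. \<open>Y 0\<close> and \<open>U 0\<close> lie outside the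
      family, which leaves index \<open>0\<close> free for \<open>A\<close>.\<close>
    define K :: "nat \<Rightarrow> (unit + nat + nat) set" where
      "K j = (if j = 0 then {Inl ()} else {Inr (Inl j), Inr (Inr j)})" for j
    define h :: "nat \<Rightarrow> (unit + nat + nat \<Rightarrow> real) \<Rightarrow> complex" where
      "h j f = (if j = 0 then complex_of_real (f (Inl ())) else iexp (- (t * f (Inr (Inl j)))) *
        complex_of_real (exp (\<eta> * (f (Inr (Inl j)) * indicator {..\<xi>} (f (Inr (Inr j)))))))" for j f
    have "indep_vars (\<lambda>j. PiM (K j) (\<lambda>_. borel)) (\<lambda>j \<omega>. restrict (\<lambda>i.
        case_sum (\<lambda>_::unit. \<lambda>\<omega>. real (A \<omega>)) (case_sum Y U) i \<omega>) (K j)) UNIV"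
      by (rule indep_vars_restrict[OF indep]) (auto simp: disjoint_family_on_def K_def)
    then have "indep_vars (\<lambda>_. borel) (\<lambda>j \<omega>. h j (restrict (\<lambda>i.
        case_sum (\<lambda>_::unit. \<lambda>\<omega>. real (A \<omega>)) (case_sum Y U) i \<omega>) (K j))) UNIV"
    proof (rule indep_vars_compose2)
      fix j :: nat
      show "h j \<in> borel_measurable (PiM (K j) (\<lambda>_. borel))"
      proof (cases "j = 0")
        case True
        have [measurable]: "Inl () \<in> K 0" by (simp add: K_def)
        show ?thesis using True unfolding h_def[abs_def] by simp
      next
        case False
        then have [measurable]: "Inr (Inl j) \<in> K j" "Inr (Inr j) \<in> K j" by (simp_all add: K_def)
        show ?thesis using False unfolding h_def[abs_def] by simp
      qed
    qed
    moreover have "(\<lambda>j \<omega>. h j (restrict (\<lambda>i.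
          case_sum (\<lambda>_::unit. \<lambda>\<omega>. real (A \<omega>)) (case_sum Y U) i \<omega>) (K j)))
        = (\<lambda>j \<omega>. if j = 0 then of_nat (A \<omega>) else W t j \<omega>)"
      by (simp add: fun_eq_iff h_def W_def K_def)
    ultimately show ?thesis by simp
  qed

  define b where "b = expectation (\<lambda>\<omega>. exp (\<eta> * Y 1 \<omega>))"
  have W_int: "integrable M (W t j)" if "j \<ge> 1" for t j
    unfolding W_def
    by (rule integrable_thinned_summand[OF indep_YU Y_dens \<mu>_nonneg U_distr exp_int \<xi>]) fact+
  have W_exp: "expectation (W t j) = fourier (\<lambda>z. complex_of_real (\<xi> * \<mu>' z + (1 - \<xi>) * \<mu> z)) t"
    if "j \<ge> 1" for t j
    unfolding W_def \<mu>'_def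
    by (rule expectation_thinned_summand[OF indep_YU Y_dens \<mu>_nonneg U_distr exp_int \<xi>]) fact+
  have W_norm: "expectation (\<lambda>\<omega>. norm (W t j \<omega>)) \<le> b" if "j \<ge> 1" for t j
    unfolding b_def exp_eq[OF that, symmetric]
  proof (rule integral_mono)
    show "integrable M (\<lambda>\<omega>. norm (W t j \<omega>))" using W_int[OF that] by simp
    show "integrable M (\<lambda>\<omega>. exp (\<eta> * Y j \<omega>))" by (rule exp_int[OF that])
    \<comment> \<open>The phase has modulus one, and thinning can only lower the exponent because
      \<open>\<eta>\<close> and \<open>Y j \<omega>\<close> are nonnegative.\<close>
    show "norm (W t j \<omega>) \<le> exp (\<eta> * Y j \<omega>)" if "\<omega> \<in> space M" for \<omega>
      using \<open>\<eta> > 0\<close> Y_nonneg[OF \<open>j \<ge> 1\<close> that] by (simp add: W_def norm_mult indicator_def)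
  qed
  have summ: "summable (\<lambda>k. weight M A k * b ^ k)"
    unfolding b_def
  proof (rule ratio_condition_summable[OF rc])
    have "(1::real) = expectation (\<lambda>\<omega>. 1)" by (simp add: prob_space)
    also have "\<dots> \<le> expectation (\<lambda>\<omega>. exp (\<eta> * Y 1 \<omega>))"
      using \<open>\<eta> > 0\<close> Y_nonneg[of 1] by (intro integral_mono exp_int) auto
    finally show "0 < expectation (\<lambda>\<omega>. exp (\<eta> * Y 1 \<omega>))" by simp
  qed

  have prod_W: "(\<Prod>j = 1..A \<omega>. W t j \<omega>) = E \<omega> *\<^sub>R iexp (- (t * Z \<omega>))" for t \<omega>
  proof -
    have "E \<omega> = (\<Prod>j = 1..A \<omega>. exp (\<eta> * (Y j \<omega> * indicator {..\<xi>} (U j \<omega>))))"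
      by (simp only: E_def thinned_sum_def sum_distrib_left exp_sum finite_atLeastAtMost)
    moreover have "iexp (- (t * Z \<omega>)) = (\<Prod>j = 1..A \<omega>. iexp (- (t * Y j \<omega>)))"
      by (simp add: Z_def compound_sum_def sum_distrib_left exp_sum flip: sum_negf)
    ultimately show ?thesis
      by (simp only: W_def prod.distrib scaleR_conv_of_real of_real_prod mult.commute)
  qed
  have transform_int: "integrable M (\<lambda>\<omega>. E \<omega> *\<^sub>R iexp (- (t * Z \<omega>)))" for t
    using integrable_random_prod[OF A A1 indep_W W_int W_exp W_norm summ, of t]
    by (simp only: prod_W)
  have transform: "expectation (\<lambda>\<omega>. E \<omega> *\<^sub>R iexp (- (t * Z \<omega>))) = g t" for t
    using expectation_random_prod[OF A A1 indep_W W_int W_exp W_norm summ, of t]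
    by (simp only: prod_W g_def)
  \<comment> \<open>At frequency \<open>0\<close> the phase is constantly one and only the weight
    remains.\<close>
  have E_int: "integrable M E"
    using transform_int[of 0] by (simp add: scaleR_conv_of_real complex_of_real_integrable_eq)
  then have [measurable]: "E \<in> borel_measurable M" by simp
  \<comment> \<open>\<open>A\<close> takes countably many values, so measurability reduces to sums
    of fixed length.\<close>
  have Z_meas[measurable]: "Z \<in> borel_measurable M"
    unfolding Z_def compound_sum_def[abs_def]
    by (rule measurable_compose_countable[OF _ A]) (auto intro!: borel_measurable_sum Y_meas)
  have Z_nonneg: "Z \<omega> \<ge> 0" if "\<omega> \<in> space M" for \<omega>
    unfolding Z_def compound_sum_def using Y_nonneg that by (intro sum_nonneg) auto

  obtain D :: "real \<Rightarrow> real" where D[measurable]: "D \<in> borel_measurable borel"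
    and D_int: "\<And>F :: real \<Rightarrow> complex. F \<in> borel_measurable borel \<Longrightarrow>
       integrable lborel (\<lambda>x. D x *\<^sub>R F x) \<longleftrightarrow> integrable M (\<lambda>\<omega>. E \<omega> *\<^sub>R F (Z \<omega>))"
    and D_eq: "\<And>F :: real \<Rightarrow> complex. F \<in> borel_measurable borel \<Longrightarrow>
       (\<integral>x. D x *\<^sub>R F x \<partial>lborel) = expectation (\<lambda>\<omega>. E \<omega> *\<^sub>R F (Z \<omega>))"
  proof (rule weighted_law_density[OF Z_meas E_int])
    show "0 \<le> E \<omega>" for \<omega> by (simp add: E_def)
    show "AE \<omega> in M. P (Z \<omega>)" if "AE x in lborel. P x" for P
      unfolding Z_def by (rule AE_compound_sum[OF A1 indep_Y Y_dens that])
  qed blast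
  \<comment> \<open>The test function \<open>1\<close> gives integrability of \<open>D\<close> and
    the phases give its transform; this settles the existence of an inverse transform.\<close>
  have "integrable lborel (\<lambda>x. complex_of_real (D x))"
    using D_int[of "\<lambda>_. 1"] transform_int[of 0] by (simp add: scaleR_conv_of_real)
  moreover have "fourier (\<lambda>x. complex_of_real (D x)) t = g t" for t
    using D_eq[of "\<lambda>x. iexp (- (t * x))"] transform[of t]
    by (simp add: fourier_def scaleR_conv_of_real mult.commute)
  ultimately have D_inv: "is_inverse_fourier g (\<lambda>x. complex_of_real (D x))"
    by (auto simp: is_inverse_fourier_def)

  \<comment> \<open>\<open>\<sigma>\<close> is controlled only on the half-line. Cutting it off to
    the left of \<open>0\<close> gives a Borel function on the whole line, and its values at
    \<open>Z \<omega> \<ge> 0\<close> are unchanged.\<close>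
  define \<sigma>' where "\<sigma>' z = indicator {0..} z *\<^sub>R \<sigma> z" for z
  have [measurable]: "\<sigma>' \<in> borel_measurable borel"
    using \<sigma>_meas unfolding \<sigma>'_def[abs_def] by (subst (asm) borel_measurable_restrict_space_iff) auto
  have X_eq: "X \<omega> = \<sigma>' (Z \<omega>) * E \<omega>" if "\<omega> \<in> space M" for \<omega>
    using Z_nonneg[OF that] by (simp add: X_def \<sigma>'_def)
  obtain C where C: "\<And>z. z \<ge> 0 \<Longrightarrow> \<bar>\<sigma> z\<bar> \<le> C"
    using \<sigma>_bounded by (auto simp: bounded_iff)
  have X_int: "integrable M X"
  proof (rule Bochner_Integration.integrable_bound)
    show "integrable M (\<lambda>\<omega>. C * E \<omega>)" using E_int by simp
    show "X \<in> borel_measurable M"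
      by (subst measurable_cong[OF X_eq]) auto
    have "norm (X \<omega>) \<le> norm (C * E \<omega>)" if "\<omega> \<in> space M" for \<omega>
      using C[OF Z_nonneg[OF that]] by (auto simp: X_def abs_mult intro!: mult_right_mono)
    then show "AE \<omega> in M. norm (X \<omega>) \<le> norm (C * E \<omega>)" by auto
  qed
  have "complex_of_real (expectation X) = (CLINT z:{0..}|lborel. complex_of_real (\<sigma> z) * f z)"
    if f: "is_inverse_fourier g f" for f
  proof -
    have [measurable]: "f \<in> borel_measurable borel"
      using f by (auto simp: is_inverse_fourier_def)
    \<comment> \<open>Every version of the inverse transform agrees with \<open>D\<close> almost
      everywhere, so the integral can be computed with \<open>D\<close> instead.\<close>
    have ae: "AE z in lborel. f z = complex_of_real (D z)"
      using f D_inv by (intro fourier_inj) (auto simp: is_inverse_fourier_def)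
    have "(CLINT z:{0..}|lborel. complex_of_real (\<sigma> z) * f z) = (CLINT z|lborel. complex_of_real (\<sigma>' z) * f z)"
      by (auto simp: set_lebesgue_integral_def \<sigma>'_def scaleR_conv_of_real mult.assoc)
    also have "\<dots> = (CLINT z|lborel. D z *\<^sub>R complex_of_real (\<sigma>' z))"
      using ae by (intro integral_cong_AE) (auto simp: scaleR_conv_of_real)
    also have "\<dots> = expectation (\<lambda>\<omega>. E \<omega> *\<^sub>R complex_of_real (\<sigma>' (Z \<omega>)))"
      by (rule D_eq) measurable
    also have "\<dots> = expectation (\<lambda>\<omega>. complex_of_real (X \<omega>))"
      by (intro Bochner_Integration.integral_cong) (auto simp: X_eq scaleR_conv_of_real)
    finally show ?thesis by simp
  qed
  with X_int D_inv have "integrable M X \<and> (\<exists>f. is_inverse_fourier g f) \<and>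
      (\<forall>f. is_inverse_fourier g f \<longrightarrow> complex_of_real (expectation X)
         = (CLINT z:{0..}|lborel. complex_of_real (\<sigma> z) * f z))"
    by blast
  then show ?thesis
    unfolding Let_def X_def g_def \<mu>'_def E_def Z_def .
qed

end
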